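(* $L$-equivalence of braids is the same as the usual Markov equivalence: two braids $\alpha\in B_n$ and $\beta\in B_m$ (for any $n,m\ge 1$) are $L$-equivalent if and only if they are related by a finite sequence of the moves (i) conjugation: $\alpha\sim\beta^{-1}\alpha\beta$ for $\alpha,\beta\in B_n$; (ii) Markov moves: $\alpha\sim\alpha\sigma_n\in B_{n+1}$ and $\alpha\sim\alpha\sigma_n^{-1}\in B_{n+1}$ for $\alpha\in B_n$, and their inverses.
   Context: $B_n$ is the braid group on $n$ strands with standard generators $\sigma_1,\dots,\sigma_{n-1}$, i.e. geometric braid diagrams on $n$ strands (strands running monotonically from top to bottom, oriented downwards) modulo isotopy, with concatenation as operation. $L$-moves. Let $P$ be a point of an arc of a braid diagram, not vertically aligned with any crossing or other vertex. An $L$-move at $P$: cut the arc at $P$, bend the two resulting smaller arcs slightly apart by a small isotopy, and introduce two new vertical arcs to a new top and a new bottom end-point on the vertical line of $P$: one from the new top end-point down to the start of the outgoing piece, the other from the end of the incoming piece down to the new bottom end-point. Both new arcs are oriented downwards and run either both under or both over all other arcs of the diagram. $L$-equivalence is the equivalence relation on the set of all braids generated by $L$-moves and braid isotopy. *)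

theory Defs
  imports "HOL-Algebra.Group"
begin

section \<open>Braid diagrams and the braid groups\<close>

text \<open>
  A braid diagram on \<open>n\<close> strands is given by its list of crossings, read from top to bottom.
  Strand positions are numbered \<open>1, \<dots>, n\<close> from left to right.  The crossing \<open>(i, True)\<close>
  exchanges the strands at positions \<open>i\<close> and \<open>i + 1\<close> and the strand running
  from position \<open>i\<close> (above) to position \<open>i + 1\<close> (below) passes over; in \<open>(i, False)\<close> that strand
  passes under.  Concatenation of lists stacks the first diagram on top of the second.
\<close>

type_synonym braid_diagram = "(nat \<times> bool) list"

definition braid_diagrams :: "nat \<Rightarrow> braid_diagram set" where
  "braid_diagrams n = lists ({1..<n} \<times> UNIV)"

text \<open>
  Braid isotopy is generated by the second and third Reidemeister moves and by exchanging
  the heights of two horizontally distant crossings.  The third Reidemeister move is needed only for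
  positive crossings, the other cases being consequences.
\<close>

inductive isotopy_move :: "nat \<Rightarrow> braid_diagram \<Rightarrow> braid_diagram \<Rightarrow> bool" for n where
  cancel: "1 \<le> i \<Longrightarrow> i < n \<Longrightarrow> isotopy_move n (u @ [(i, s), (i, \<not> s)] @ v) (u @ v)"
| far: "1 \<le> i \<Longrightarrow> i + 1 < j \<Longrightarrow> j < n \<Longrightarrow>
    isotopy_move n (u @ [(i, s), (j, t)] @ v) (u @ [(j, t), (i, s)] @ v)"
| reidemeister3: "1 \<le> i \<Longrightarrow> i + 1 < n \<Longrightarrow>
    isotopy_move n (u @ [(i, True), (i + 1, True), (i, True)] @ v)
                   (u @ [(i + 1, True), (i, True), (i + 1, True)] @ v)"

definition isotopy :: "nat \<Rightarrow> (braid_diagram \<times> braid_diagram) set" where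
  "isotopy n = {(v, w). v \<in> braid_diagrams n \<and> w \<in> braid_diagrams n \<and>
                        equivclp (isotopy_move n) v w}"

definition braid_of :: "nat \<Rightarrow> braid_diagram \<Rightarrow> braid_diagram set" where
  "braid_of n w = isotopy n `` {w}"

definition braid_group :: "nat \<Rightarrow> braid_diagram set monoid" where
  "braid_group n =
     \<lparr>carrier = braid_diagrams n // isotopy n,
      mult = (\<lambda>A B. \<Union>a\<in>A. \<Union>b\<in>B. braid_of n (a @ b)),
      one = braid_of n []\<rparr>"

definition sigma :: "nat \<Rightarrow> nat \<Rightarrow> braid_diagram set" where
  "sigma n i = braid_of n [(i, True)]"

text \<open>The standard embedding of the \<open>n\<close>-strand group: a new strand is added on the right.\<close>

definition add_strand :: "nat \<Rightarrow> braid_diagram set \<Rightarrow> braid_diagram set" where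
  "add_strand n A = (\<Union>a\<in>A. braid_of (Suc n) a)"

lemma equiv_isotopy: "equiv (braid_diagrams n) (isotopy n)"
proof (rule equivI)
  show "isotopy n \<subseteq> braid_diagrams n \<times> braid_diagrams n"
    by (auto simp: isotopy_def)
  show "refl_on (braid_diagrams n) (isotopy n)"
    by (auto simp: isotopy_def refl_on_def)
  show "sym (isotopy n)"
    by (auto simp: isotopy_def sym_def intro: equivclp_sym)
  show "trans (isotopy n)"
    by (auto simp: isotopy_def trans_def intro: equivclp_trans)
qed

lemma isotopy_move_append:
  "isotopy_move n v w \<Longrightarrow> isotopy_move n (x @ v @ y) (x @ w @ y)"
proof (induction rule: isotopy_move.induct)
  case (cancel i u s v)
  then show ?case using isotopy_move.cancel[of i n "x @ u" s "v @ y"] by simp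
next
  case (far i j u s t v)
  then show ?case using isotopy_move.far[of i j n "x @ u" s t "v @ y"] by simp
next
  case (reidemeister3 i u v)
  then show ?case using isotopy_move.reidemeister3[of i n "x @ u" "v @ y"] by simp
qed

lemma equivclp_isotopy_move_append:
  "equivclp (isotopy_move n) v w \<Longrightarrow> equivclp (isotopy_move n) (x @ v @ y) (x @ w @ y)"
proof (induction rule: equivclp_induct)
  case base
  show ?case by simp
next
  case (step b c)
  then have "equivclp (isotopy_move n) (x @ b @ y) (x @ c @ y)"
    by (meson isotopy_move_append r_into_equivclp equivclp_sym)
  with step.IH show ?case by (rule equivclp_trans)
qed

lemma isotopy_append:
  assumes "(a, a') \<in> isotopy n" "(b, b') \<in> isotopy n"
  shows "(a @ b, a' @ b') \<in> isotopy n"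
proof -
  have "equivclp (isotopy_move n) (a @ b) (a' @ b)"
    using assms equivclp_isotopy_move_append[of n a a' "[]" b] by (simp add: isotopy_def)
  moreover have "equivclp (isotopy_move n) (a' @ b) (a' @ b')"
    using assms equivclp_isotopy_move_append[of n b b' a' "[]"] by (simp add: isotopy_def)
  ultimately show ?thesis
    using assms by (auto simp: isotopy_def braid_diagrams_def intro: equivclp_trans)
qed

lemma braid_of_eq_iff:
  "v \<in> braid_diagrams n \<Longrightarrow> w \<in> braid_diagrams n \<Longrightarrow>
   braid_of n v = braid_of n w \<longleftrightarrow> (v, w) \<in> isotopy n"
  unfolding braid_of_def using equiv_isotopy by (rule eq_equiv_class_iff)

lemma carrier_braid_group: "carrier (braid_group n) = braid_of n ` braid_diagrams n"
  by (auto simp: braid_group_def braid_of_def quotient_def)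

lemma append_in_braid_diagrams:
  "a @ b \<in> braid_diagrams n \<longleftrightarrow> a \<in> braid_diagrams n \<and> b \<in> braid_diagrams n"
  by (auto simp: braid_diagrams_def)

lemma mult_braid_of:
  assumes "a \<in> braid_diagrams n" "b \<in> braid_diagrams n"
  shows "braid_of n a \<otimes>\<^bsub>braid_group n\<^esub> braid_of n b = braid_of n (a @ b)"
proof -
  have self: "x \<in> braid_of n x" if "x \<in> braid_diagrams n" for x
    using that by (simp add: braid_of_def isotopy_def)
  have "braid_of n (a' @ b') = braid_of n (a @ b)"
    if "a' \<in> braid_of n a" "b' \<in> braid_of n b" for a' b'
  proof -
    have "(a @ b, a' @ b') \<in> isotopy n"
      using that isotopy_append by (auto simp: braid_of_def)
    then show ?thesis
      unfolding braid_of_def using equiv_class_eq[OF equiv_isotopy] by blast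
  qed
  then have "(\<Union>x\<in>braid_of n a. \<Union>y\<in>braid_of n b. braid_of n (x @ y)) = braid_of n (a @ b)"
    using self[OF assms(1)] self[OF assms(2)] by blast
  then show ?thesis by (simp add: braid_group_def)
qed

lemma one_braid_group: "\<one>\<^bsub>braid_group n\<^esub> = braid_of n []"
  by (simp add: braid_group_def)

lemma left_inverse_diagram:
  "w \<in> braid_diagrams n \<Longrightarrow>
   equivclp (isotopy_move n) (rev (map (\<lambda>(i, s). (i, \<not> s)) w) @ w) []"
proof (induction w)
  case Nil
  show ?case by simp
next
  case (Cons a w)
  obtain i s where a: "a = (i, s)" by force
  have "1 \<le> i" "i < n" using Cons.prems by (auto simp: a braid_diagrams_def)
  then have "equivclp (isotopy_move n)
      (rev (map (\<lambda>(i, s). (i, \<not> s)) w) @ [(i, \<not> s), (i, s)] @ w)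
      (rev (map (\<lambda>(i, s). (i, \<not> s)) w) @ w)"
    using isotopy_move.cancel[of i n _ "\<not> s"] by (intro r_into_equivclp) simp
  moreover have "equivclp (isotopy_move n) (rev (map (\<lambda>(i, s). (i, \<not> s)) w) @ w) []"
    using Cons by (simp add: braid_diagrams_def)
  ultimately show ?case by (simp add: a) (rule equivclp_trans)
qed

theorem group_braid_group: "group (braid_group n)"
proof (rule groupI)
  fix x y assume "x \<in> carrier (braid_group n)" "y \<in> carrier (braid_group n)"
  then show "x \<otimes>\<^bsub>braid_group n\<^esub> y \<in> carrier (braid_group n)"
    by (auto simp: carrier_braid_group mult_braid_of append_in_braid_diagrams)
next
  show "\<one>\<^bsub>braid_group n\<^esub> \<in> carrier (braid_group n)"
    by (simp add: carrier_braid_group one_braid_group braid_diagrams_def)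
next
  fix x y z
  assume "x \<in> carrier (braid_group n)" "y \<in> carrier (braid_group n)" "z \<in> carrier (braid_group n)"
  then show "x \<otimes>\<^bsub>braid_group n\<^esub> y \<otimes>\<^bsub>braid_group n\<^esub> z =
             x \<otimes>\<^bsub>braid_group n\<^esub> (y \<otimes>\<^bsub>braid_group n\<^esub> z)"
    by (auto simp: carrier_braid_group mult_braid_of append_in_braid_diagrams)
next
  fix x assume "x \<in> carrier (braid_group n)"
  moreover have "[] \<in> braid_diagrams n" by (simp add: braid_diagrams_def)
  ultimately show "\<one>\<^bsub>braid_group n\<^esub> \<otimes>\<^bsub>braid_group n\<^esub> x = x"
    by (auto simp: carrier_braid_group one_braid_group mult_braid_of)
next
  fix x assume "x \<in> carrier (braid_group n)"
  then obtain w where w: "w \<in> braid_diagrams n" "x = braid_of n w"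
    by (auto simp: carrier_braid_group)
  define w' where "w' = rev (map (\<lambda>(i, s). (i, \<not> s)) w)"
  have w': "w' \<in> braid_diagrams n"
    using w(1) by (fastforce simp: w'_def braid_diagrams_def)
  have "[] \<in> braid_diagrams n" by (simp add: braid_diagrams_def)
  with left_inverse_diagram[OF w(1)] w w'
  have "braid_of n w' \<otimes>\<^bsub>braid_group n\<^esub> x = \<one>\<^bsub>braid_group n\<^esub>"
    by (simp add: mult_braid_of one_braid_group braid_of_eq_iff append_in_braid_diagrams
        isotopy_def flip: w'_def)
  with w' show "\<exists>y\<in>carrier (braid_group n). y \<otimes>\<^bsub>braid_group n\<^esub> x = \<one>\<^bsub>braid_group n\<^esub>"
    by (auto simp: carrier_braid_group)
qed

section \<open>Markov equivalence\<close>

text \<open>A pair \<open>(n, \<alpha>)\<close> stands for the braid \<open>\<alpha>\<close> on \<open>n\<close> strands.\<close>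

inductive markov_move :: "nat \<times> braid_diagram set \<Rightarrow> nat \<times> braid_diagram set \<Rightarrow> bool" where
  conjugation: "1 \<le> n \<Longrightarrow> \<alpha> \<in> carrier (braid_group n) \<Longrightarrow> \<beta> \<in> carrier (braid_group n) \<Longrightarrow>
    markov_move (n, \<alpha>) (n, inv\<^bsub>braid_group n\<^esub> \<beta> \<otimes>\<^bsub>braid_group n\<^esub> \<alpha> \<otimes>\<^bsub>braid_group n\<^esub> \<beta>)"
| stabilisation_pos: "1 \<le> n \<Longrightarrow> \<alpha> \<in> carrier (braid_group n) \<Longrightarrow>
    markov_move (n, \<alpha>) (Suc n, add_strand n \<alpha> \<otimes>\<^bsub>braid_group (Suc n)\<^esub> sigma (Suc n) n)"
| stabilisation_neg: "1 \<le> n \<Longrightarrow> \<alpha> \<in> carrier (braid_group n) \<Longrightarrow>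
    markov_move (n, \<alpha>) (Suc n, add_strand n \<alpha> \<otimes>\<^bsub>braid_group (Suc n)\<^esub>
                               inv\<^bsub>braid_group (Suc n)\<^esub> (sigma (Suc n) n))"

definition markov_equivalent ::
    "nat \<times> braid_diagram set \<Rightarrow> nat \<times> braid_diagram set \<Rightarrow> bool" where
  "markov_equivalent = equivclp markov_move"

section \<open>L-moves\<close>

text \<open>
  To perform an L-move at a point \<open>P\<close> of a diagram one needs to know how the diagram lies with
  respect to the vertical line through \<open>P\<close>.  A diagram drawn in the plane together with a vertical
  line in general position is described by its list of events, from top to bottom: a crossing
  of the diagram (away from the line), or a strand passing through the line from left to
  right or from right to left.  At every height, the number \<open>c\<close> of strands to the left of the line is
  recorded; this number changes exactly when a strand passes through the line.
  Positions in \<open>Crossing i s\<close> refer to the diagram without the line, so a crossing away from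
  the line is one with \<open>i \<noteq> c\<close>.
\<close>

datatype event = Crossing nat bool | Left_to_Right | Right_to_Left

fun line_position :: "nat \<Rightarrow> event list \<Rightarrow> nat" where
  "line_position c [] = c"
| "line_position c (Crossing i s # es) = line_position c es"
| "line_position c (Left_to_Right # es) = line_position (c - 1) es"
| "line_position c (Right_to_Left # es) = line_position (c + 1) es"

fun valid_events :: "nat \<Rightarrow> nat \<Rightarrow> event list \<Rightarrow> bool" where
  "valid_events n c [] \<longleftrightarrow> c \<le> n"
| "valid_events n c (Crossing i s # es) \<longleftrightarrow> 1 \<le> i \<and> i < n \<and> i \<noteq> c \<and> valid_events n c es"
| "valid_events n c (Left_to_Right # es) \<longleftrightarrow> 1 \<le> c \<and> c \<le> n \<and> valid_events n (c - 1) es"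
| "valid_events n c (Right_to_Left # es) \<longleftrightarrow> c < n \<and> valid_events n (c + 1) es"

text \<open>The end-points at the top and at the bottom of a braid have the same horizontal positions.
  Hence the line has equally many of them to its left at the top and at the bottom.\<close>

definition diagram_with_line :: "nat \<Rightarrow> nat \<Rightarrow> event list \<Rightarrow> bool" where
  "diagram_with_line n c es \<longleftrightarrow> valid_events n c es \<and> line_position c es = c"

fun forget_line :: "event list \<Rightarrow> braid_diagram" where
  "forget_line [] = []"
| "forget_line (Crossing i s # es) = (i, s) # forget_line es"
| "forget_line (Left_to_Right # es) = forget_line es"
| "forget_line (Right_to_Left # es) = forget_line es"

text \<open>
  The diagram in which the line becomes a strand, at position \<open>c + 1\<close>, running over
  (\<open>ov = True\<close>) or under (\<open>ov = False\<close>) all others.  When another strand passes from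
  left to right, the line goes from position \<open>c + 1\<close> to position \<open>c\<close>; when another
  strand passes from right to left, the line goes from position \<open>c + 1\<close> to position \<open>c + 2\<close>.
\<close>

fun draw_line :: "bool \<Rightarrow> nat \<Rightarrow> event list \<Rightarrow> braid_diagram" where
  "draw_line ov c [] = []"
| "draw_line ov c (Crossing i s # es) = (if i < c then i else i + 1, s) # draw_line ov c es"
| "draw_line ov c (Left_to_Right # es) = (c, \<not> ov) # draw_line ov (c - 1) es"
| "draw_line ov c (Right_to_Left # es) = (c + 1, ov) # draw_line ov (c + 1) es"

text \<open>
  The point \<open>P\<close> lies on its own vertical line, and is a point \<open>e\<close> where a strand passes
  through that line (if the strand is vertical near \<open>P\<close> or only touches the line there, bending
  its two halves apart puts it into this form).  Cutting at \<open>P\<close>, the incoming piece arrives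
  on one side of the line and continues as the new arc down to the bottom, while the new arc from
  the top continues as the outgoing piece, on the other side of the line.  No crossing arises at
  \<open>P\<close>, so the event \<open>e\<close> leaves no trace in the new diagram except that below it the
  line has one strand less, or one more, to its left.
\<close>

inductive L_move :: "nat \<times> braid_diagram set \<Rightarrow> nat \<times> braid_diagram set \<Rightarrow> bool" where
  "diagram_with_line n c (us @ e # vs) \<Longrightarrow> e \<in> {Left_to_Right, Right_to_Left} \<Longrightarrow>
   L_move (n, braid_of n (forget_line (us @ e # vs)))
          (Suc n, braid_of (Suc n)
             (draw_line ov c us @ draw_line ov (line_position c (us @ [e])) vs))"

definition L_equivalent ::
    "nat \<times> braid_diagram set \<Rightarrow> nat \<times> braid_diagram set \<Rightarrow> bool" where
  "L_equivalent = equivclp L_move"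

lemma valid_events_append:
  "valid_events n c (es @ fs) \<longleftrightarrow> valid_events n c es \<and> valid_events n (line_position c es) fs"
proof -
  have le: "valid_events k d fs \<Longrightarrow> d \<le> k" for k d
    by (induction k d fs rule: valid_events.induct) auto
  show ?thesis
    by (induction n c es rule: valid_events.induct) (auto dest: le)
qed

lemma forget_line_in_braid_diagrams:
  "valid_events n c es \<Longrightarrow> forget_line es \<in> braid_diagrams n"
  by (induction n c es rule: valid_events.induct) (auto simp: braid_diagrams_def)

lemma draw_line_in_braid_diagrams:
  "valid_events n c es \<Longrightarrow> draw_line ov c es \<in> braid_diagrams (Suc n)"
  by (induction n c es rule: valid_events.induct) (auto simp: braid_diagrams_def)

lemma L_move_braids:
  assumes "L_move (n, \<alpha>) (m, \<beta>)"
  shows "1 \<le> n \<and> m = Suc n \<and> \<alpha> \<in> carrier (braid_group n) \<and> \<beta> \<in> carrier (braid_group m)"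
  using assms
proof cases
  case (1 c us e vs ov)
  from 1 have valid: "valid_events n c (us @ e # vs)"
    by (simp add: diagram_with_line_def)
  then have us: "valid_events n c us"
    by (simp add: valid_events_append)
  from valid 1 have vs: "1 \<le> n" "valid_events n (line_position c (us @ [e])) vs"
    using valid_events_append[of n c "us @ [e]" vs] valid_events_append[of n c us "[e]"] by auto
  have "draw_line ov c us @ draw_line ov (line_position c (us @ [e])) vs \<in> braid_diagrams (Suc n)"
    using draw_line_in_braid_diagrams[OF us] draw_line_in_braid_diagrams[OF vs(2)]
    by (simp add: append_in_braid_diagrams)
  with 1 vs forget_line_in_braid_diagrams[OF valid] show ?thesis
    by (simp add: carrier_braid_group)
qed

end

theory Submission
  imports Defs
begin

text \<open>
  The new arcs of an L-move run over (or under) everything else, so they can be pulled to the far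
  right.  Let \<open>D\<^sub>c = \<sigma>\<^sub>n\<^sup>e \<dots> \<sigma>\<^sub>c\<^sub>+\<^sub>1\<^sup>e\<close> (\<open>comb n e c\<close>) be the braid on \<open>n + 1\<close> strands in which the last strand moves to
  position \<open>c + 1\<close>, in front of the others or behind them according to the sign \<open>e\<close>.
  Sliding a braid \<open>w\<close> on \<open>n\<close> strands through \<open>D\<^sub>c\<close> shows that a line which
  follows \<open>w\<close> from position \<open>c\<close> to position \<open>d\<close> gives the braid \<open>D\<^sub>c\<inverse> w D\<^sub>d\<close> (\<open>draw_line_isotopic\<close>).
  Since lines can be steered at will (\<open>line_steering\<close>), the L-moves are exactly the passages
    \<open>a b \<mapsto> D\<^sub>c\<inverse> a D\<^sub>p D\<^sub>q\<inverse> b D\<^sub>c\<close>  with  \<open>\<bar>p - q\<bar> = 1\<close>  (\<open>L_move_cases\<close>, \<open>L_move_wordI\<close>).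

  From L-moves to Markov moves: \<open>D\<^sub>p D\<^sub>q\<inverse>\<close> has the form \<open>D\<^sub>r \<sigma>\<^sub>r\<^sup>t D\<^sub>r\<inverse>\<close>, which equals \<open>g \<sigma>\<^sub>n\<^sup>t g\<inverse>\<close> for
  a braid \<open>g\<close> on the first \<open>n\<close> strands (\<open>comb_conjugate\<close>).  Hence the right-hand side above is
  conjugate to \<open>g\<inverse> b a g \<sigma>\<^sub>n\<^sup>t\<close>, a stabilisation of a conjugate of \<open>a b\<close>.

  From Markov moves to L-moves: \<open>c = p = n\<close>, \<open>q = n - 1\<close>, \<open>b = 1\<close> gives the stabilisation of \<open>a\<close>.
  As for conjugation, one L-move leads from \<open>a \<sigma>\<^sub>i\<^sup>e\<close> and one from \<open>\<sigma>\<^sub>i\<^sup>e a\<close> to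
  the same braid \<open>D\<^sub>i\<^sub>+\<^sub>1\<inverse> a D\<^sub>i\<^sub>-\<^sub>1\<close> (\<open>L_rotate_letter\<close>); so any word may be rotated
  letter by letter, and \<open>\<beta>\<inverse> \<alpha> \<beta>\<close> becomes \<open>\<beta> \<beta>\<inverse> \<alpha> = \<alpha>\<close>.
\<close>

section \<open>Calculating with braid words\<close>

abbreviation isotopic :: "braid_diagram \<Rightarrow> nat \<Rightarrow> braid_diagram \<Rightarrow> bool"
    ("(_ \<approx>\<^bsub>_\<^esub> _)" [51, 0, 51] 50) where
  "v \<approx>\<^bsub>n\<^esub> w \<equiv> equivclp (isotopy_move n) v w"

lemma isotopic_trans [trans]: "u \<approx>\<^bsub>n\<^esub> v \<Longrightarrow> v \<approx>\<^bsub>n\<^esub> w \<Longrightarrow> u \<approx>\<^bsub>n\<^esub> w"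
  by (rule equivclp_trans)

lemma isotopic_append: "a \<approx>\<^bsub>n\<^esub> a' \<Longrightarrow> b \<approx>\<^bsub>n\<^esub> b' \<Longrightarrow> a @ b \<approx>\<^bsub>n\<^esub> a' @ b'"
  using equivclp_isotopy_move_append[of n a a' "[]" b] equivclp_isotopy_move_append[of n b b' a' "[]"]
  by (auto intro: equivclp_trans)

lemma isotopic_prepend: "b \<approx>\<^bsub>n\<^esub> b' \<Longrightarrow> a @ b \<approx>\<^bsub>n\<^esub> a @ b'"
  by (simp add: isotopic_append)

lemma isotopic_context: "v \<approx>\<^bsub>n\<^esub> w \<Longrightarrow> x @ v @ y \<approx>\<^bsub>n\<^esub> x @ w @ y"
  by (rule equivclp_isotopy_move_append)

lemma isotopic_mono:
  assumes "v \<approx>\<^bsub>n\<^esub> w" "n \<le> m"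
  shows "v \<approx>\<^bsub>m\<^esub> w"
proof -
  have mono: "isotopy_move m a b" if "isotopy_move n a b" for a b
    using that
  proof cases
    case (cancel i u s v)
    then show ?thesis using \<open>n \<le> m\<close> isotopy_move.cancel[of i m u s v] by simp
  next
    case (far i j u s t v)
    then show ?thesis using \<open>n \<le> m\<close> isotopy_move.far[of i j m u s t v] by simp
  next
    case (reidemeister3 i u v)
    then show ?thesis using \<open>n \<le> m\<close> isotopy_move.reidemeister3[of i m u v] by simp
  qed
  show ?thesis
    using assms(1)
  proof (induction rule: equivclp_induct)
    case base
    show ?case by simp
  next
    case (step y z)
    from step.hyps(2) have "y \<approx>\<^bsub>m\<^esub> z"
      by (meson mono r_into_equivclp equivclp_sym)
    with step.IH show ?case by (rule equivclp_trans)
  qed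
qed

lemma Nil_in_braid_diagrams [simp]: "[] \<in> braid_diagrams n"
  by (simp add: braid_diagrams_def)

lemma Cons_in_braid_diagrams [simp]:
  "(i, s) # w \<in> braid_diagrams n \<longleftrightarrow> 1 \<le> i \<and> i < n \<and> w \<in> braid_diagrams n"
  by (auto simp: braid_diagrams_def)

declare append_in_braid_diagrams [simp]

lemma braid_diagrams_Suc: "w \<in> braid_diagrams n \<Longrightarrow> w \<in> braid_diagrams (Suc n)"
  by (fastforce simp: braid_diagrams_def)

lemma isotopic_in_braid_diagrams:
  assumes "v \<approx>\<^bsub>n\<^esub> w"
  shows "v \<in> braid_diagrams n \<longleftrightarrow> w \<in> braid_diagrams n"
proof -
  have move: "a \<in> braid_diagrams n \<longleftrightarrow> b \<in> braid_diagrams n" if "isotopy_move n a b" for a b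
    using that by cases auto
  show ?thesis
    using assms by (induction rule: equivclp_induct) (auto dest: move)
qed

text \<open>Isotopic words are either both diagrams on \<open>n\<close> strands or both not, and on the latter
  \<open>braid_of n\<close> is constantly empty.\<close>

lemma braid_of_eqI:
  assumes "v \<approx>\<^bsub>n\<^esub> w"
  shows "braid_of n v = braid_of n w"
  using assms isotopic_in_braid_diagrams[OF assms]
  by (auto simp: braid_of_def isotopy_def intro: equivclp_trans equivclp_sym)

definition inverse_word :: "braid_diagram \<Rightarrow> braid_diagram" where
  "inverse_word w = rev (map (\<lambda>(i, s). (i, \<not> s)) w)"

lemma inverse_word_simps [simp]:
  "inverse_word [] = []"
  "inverse_word ((i, s) # w) = inverse_word w @ [(i, \<not> s)]"
  "inverse_word (v @ w) = inverse_word w @ inverse_word v"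
  "inverse_word (inverse_word w) = w"
  by (auto simp: inverse_word_def rev_map comp_def case_prod_beta)

lemma inverse_word_in_braid_diagrams [simp]:
  "inverse_word w \<in> braid_diagrams n \<longleftrightarrow> w \<in> braid_diagrams n"
  by (induction w) auto

lemma inverse_word_left: "w \<in> braid_diagrams n \<Longrightarrow> inverse_word w @ w \<approx>\<^bsub>n\<^esub> []"
  unfolding inverse_word_def by (rule left_inverse_diagram)

lemma inverse_word_right: "w \<in> braid_diagrams n \<Longrightarrow> w @ inverse_word w \<approx>\<^bsub>n\<^esub> []"
  using inverse_word_left[of "inverse_word w" n] by simp

lemma cancel_left:
  "w \<in> braid_diagrams n \<Longrightarrow> x @ inverse_word w @ w @ y \<approx>\<^bsub>n\<^esub> x @ y"
  using isotopic_context[OF inverse_word_left[of w n], of x y] by simp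

lemma cancel_right:
  "w \<in> braid_diagrams n \<Longrightarrow> x @ w @ inverse_word w @ y \<approx>\<^bsub>n\<^esub> x @ y"
  using isotopic_context[OF inverse_word_right[of w n], of x y] by simp

lemma isotopic_inverse_word:
  assumes "v \<approx>\<^bsub>n\<^esub> w" "v \<in> braid_diagrams n"
  shows "inverse_word v \<approx>\<^bsub>n\<^esub> inverse_word w"
proof -
  have w: "w \<in> braid_diagrams n"
    using assms isotopic_in_braid_diagrams by blast
  have "inverse_word v \<approx>\<^bsub>n\<^esub> inverse_word v @ w @ inverse_word w"
    using cancel_right[OF w, of "inverse_word v" "[]"] by (simp add: equivclp_sym)
  also have "\<dots> \<approx>\<^bsub>n\<^esub> inverse_word v @ v @ inverse_word w"
    by (rule isotopic_context[OF equivclp_sym[OF assms(1)]])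
  also have "\<dots> \<approx>\<^bsub>n\<^esub> inverse_word w"
    using cancel_left[OF assms(2), of "[]"] by simp
  finally show ?thesis .
qed

lemma cancel_letters: "1 \<le> i \<Longrightarrow> i < n \<Longrightarrow> [(i, s), (i, \<not> s)] \<approx>\<^bsub>n\<^esub> []"
  using isotopy_move.cancel[of i n "[]" s "[]"] by (simp add: r_into_equivclp)

lemma far_letters:
  assumes "1 \<le> i" "i + 1 < j" "j < n"
  shows "[(i, s), (j, t)] \<approx>\<^bsub>n\<^esub> [(j, t), (i, s)]"
  using isotopy_move.far[OF assms, of "[]" s t "[]"] by (simp add: r_into_equivclp)

lemma braid_relation_same_sign:
  assumes "1 \<le> i" "i + 1 < n"
  shows "[(i, e), (i + 1, e), (i, e)] \<approx>\<^bsub>n\<^esub> [(i + 1, e), (i, e), (i + 1, e)]"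
proof -
  have pos: "[(i, True), (i + 1, True), (i, True)] \<approx>\<^bsub>n\<^esub> [(i + 1, True), (i, True), (i + 1, True)]"
    using isotopy_move.reidemeister3[OF assms, of "[]" "[]"] by (simp add: r_into_equivclp)
  show ?thesis
  proof (cases e)
    case True
    with pos show ?thesis by simp
  next
    case False
    with isotopic_inverse_word[OF pos] assms show ?thesis by simp
  qed
qed

text \<open>The mixed-sign case \<open>s \<noteq> e\<close> follows from the relation with equal signs by multiplying it with
  \<open>\<sigma>\<^sub>i\<^sup>s\<close> on the left and \<open>\<sigma>\<^sub>i\<^sub>+\<^sub>1\<^sup>s\<close> on the right.  The relation says that the strand which makes the
  two crossings of sign \<open>e\<close> with the other two lies entirely in front of them or behind them, so
  that their crossing, of any sign, can slide past it.\<close>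

lemma braid_relation:
  assumes "1 \<le> i" "i + 1 < n"
  shows "[(i + 1, e), (i, e), (i + 1, s)] \<approx>\<^bsub>n\<^esub> [(i, s), (i + 1, e), (i, e)]"
proof (cases "s = e")
  case True
  with braid_relation_same_sign[OF assms, of e] show ?thesis by (simp add: equivclp_sym)
next
  case False
  then have s: "s = (\<not> e)" by simp
  have "[(i + 1, e), (i, e), (i + 1, s)] \<approx>\<^bsub>n\<^esub>
        [(i, s), (i, \<not> s)] @ [(i + 1, e), (i, e), (i + 1, s)]"
    using isotopic_context[OF cancel_letters[of i n s], of "[]"] assms by (simp add: equivclp_sym)
  also have "\<dots> \<approx>\<^bsub>n\<^esub> [(i, s)] @ [(i + 1, e), (i, e), (i + 1, e)] @ [(i + 1, s)]"
    using isotopic_context[OF braid_relation_same_sign[OF assms, of e], of "[(i, s)]" "[(i + 1, s)]"]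
    by (simp add: s)
  also have "\<dots> \<approx>\<^bsub>n\<^esub> [(i, s), (i + 1, e), (i, e)]"
    using isotopic_context[OF cancel_letters[of "i + 1" n e], of "[(i, s), (i + 1, e), (i, e)]" "[]"]
      assms by (simp add: s)
  finally show ?thesis .
qed

lemma braid_relation_mirror:
  assumes "1 \<le> i" "Suc i < n"
  shows "[(i, e), (Suc i, e), (i, s)] \<approx>\<^bsub>n\<^esub> [(Suc i, s), (i, e), (Suc i, e)]"
  using isotopic_inverse_word[OF braid_relation[of i n "\<not> e" "\<not> s"]] assms
  by (simp add: equivclp_sym)

section \<open>Passing a strand over or under a braid\<close>

text \<open>The last of \<open>n + 1\<close> strands moves left to position \<open>c + 1\<close>, crossing the strands in between on
  one level: over them if \<open>e\<close> is false, under them if \<open>e\<close> is true.  Hence a line with the level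
  \<open>ov\<close> belongs to \<open>e = (\<not> ov)\<close>.\<close>

definition comb :: "nat \<Rightarrow> bool \<Rightarrow> nat \<Rightarrow> braid_diagram" where
  "comb n e c = map (\<lambda>i. (i, e)) (rev [Suc c..<Suc n])"

lemma comb_top [simp]: "comb n e n = []"
  by (simp add: comb_def)

lemma comb_less: "c < n \<Longrightarrow> comb n e c = comb n e (Suc c) @ [(Suc c, e)]"
  by (simp add: comb_def upt_conv_Cons del: upt_Suc)

lemma comb_in_braid_diagrams [simp]: "comb n e c \<in> braid_diagrams (Suc n)"
  by (auto simp: comb_def braid_diagrams_def)

lemma comb_commute:
  assumes "1 \<le> i" "i < c" "c \<le> n"
  shows "comb n e c @ [(i, s)] \<approx>\<^bsub>Suc n\<^esub> [(i, s)] @ comb n e c"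
  using assms(3,2)
proof (induction rule: inc_induct)
  case base
  show ?case by simp
next
  case (step c)
  have "comb n e c @ [(i, s)] = comb n e (Suc c) @ [(Suc c, e), (i, s)]"
    using step by (simp add: comb_less)
  also have "\<dots> \<approx>\<^bsub>Suc n\<^esub> comb n e (Suc c) @ [(i, s), (Suc c, e)]"
    using step assms(1) by (intro isotopic_prepend equivclp_sym[OF far_letters]) auto
  also have "\<dots> \<approx>\<^bsub>Suc n\<^esub> [(i, s)] @ comb n e (Suc c) @ [(Suc c, e)]"
    using isotopic_context[OF step.IH, of "[]" "[(Suc c, e)]"] step by simp
  also have "\<dots> = [(i, s)] @ comb n e c"
    using step by (simp add: comb_less)
  finally show ?case .
qed

text \<open>Reading upwards from the bottom, the crossing is to the right of the strand that moves; this
  strand stays on one level, so the crossing slides past it by one Reidemeister move, and is to its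
  left from then on.  There the index is one less.\<close>

lemma comb_shift:
  assumes "c < i" "i < n"
  shows "comb n e c @ [(Suc i, s)] \<approx>\<^bsub>Suc n\<^esub> [(i, s)] @ comb n e c"
proof -
  have "c \<le> i - 1" using assms by simp
  then show ?thesis
  proof (induction rule: inc_induct)
    case base
    have i: "comb n e (i - 1) = comb n e (Suc i) @ [(Suc i, e), (i, e)]"
      using assms by (cases i) (simp_all add: comb_less)
    have "comb n e (i - 1) @ [(Suc i, s)] = comb n e (Suc i) @ [(i + 1, e), (i, e), (i + 1, s)]"
      unfolding i by simp
    also have "\<dots> \<approx>\<^bsub>Suc n\<^esub> comb n e (Suc i) @ [(i, s), (i + 1, e), (i, e)]"
      using assms by (intro isotopic_prepend braid_relation) auto
    also have "\<dots> = (comb n e (Suc i) @ [(i, s)]) @ [(Suc i, e), (i, e)]"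
      by simp
    also have "\<dots> \<approx>\<^bsub>Suc n\<^esub> ([(i, s)] @ comb n e (Suc i)) @ [(Suc i, e), (i, e)]"
      using assms by (intro isotopic_append comb_commute) auto
    also have "\<dots> = [(i, s)] @ comb n e (i - 1)"
      unfolding i by simp
    finally show ?case .
  next
    case (step c)
    have "comb n e c @ [(Suc i, s)] = comb n e (Suc c) @ [(Suc c, e), (Suc i, s)]"
      using step assms by (simp add: comb_less)
    also have "\<dots> \<approx>\<^bsub>Suc n\<^esub> comb n e (Suc c) @ [(Suc i, s), (Suc c, e)]"
      using step assms by (intro isotopic_prepend far_letters) auto
    also have "\<dots> \<approx>\<^bsub>Suc n\<^esub> [(i, s)] @ comb n e (Suc c) @ [(Suc c, e)]"
      using isotopic_context[OF step.IH, of "[]" "[(Suc c, e)]"] by simp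
    also have "\<dots> = [(i, s)] @ comb n e c"
      using step assms by (simp add: comb_less)
    finally show ?case .
  qed
qed

lemma valid_events_le: "valid_events n c es \<Longrightarrow> c \<le> n"
  by (induction n c es rule: valid_events.induct) auto

text \<open>Above the diagram with the line drawn, \<open>comb\<close> brings the line to its starting point from the far
  right.  Each crossing of the diagram slides up through it, and each crossing of the line with
  a strand just changes the length of the comb by one.\<close>

lemma comb_draw_line:
  "valid_events n c es \<Longrightarrow>
   comb n (\<not> ov) c @ draw_line ov c es \<approx>\<^bsub>Suc n\<^esub>
   forget_line es @ comb n (\<not> ov) (line_position c es)"
proof (induction n c es rule: valid_events.induct)
  case (1 n c)
  show ?case by simp
next
  case (2 n c i s es)
  let ?j = "if i < c then i else i + 1"
  have "comb n (\<not> ov) c @ [(?j, s)] \<approx>\<^bsub>Suc n\<^esub> [(i, s)] @ comb n (\<not> ov) c"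
    using 2 comb_commute[of i c n "\<not> ov" s] comb_shift[of c i n "\<not> ov" s]
    by (auto dest: valid_events_le)
  from isotopic_context[OF this, of "[]" "draw_line ov c es"]
  have "comb n (\<not> ov) c @ draw_line ov c (Crossing i s # es) \<approx>\<^bsub>Suc n\<^esub>
        [(i, s)] @ comb n (\<not> ov) c @ draw_line ov c es"
    by simp
  also have "\<dots> \<approx>\<^bsub>Suc n\<^esub> [(i, s)] @ forget_line es @ comb n (\<not> ov) (line_position c es)"
    using 2 by (intro isotopic_prepend) auto
  finally show ?case by simp
next
  case (3 n c es)
  then obtain d where d: "c = Suc d" "d < n" by (cases c) auto
  with 3 show ?case by (simp add: comb_less[of d n])
next
  case (4 n c es)
  then have "c < n" by simp
  have "comb n (\<not> ov) c @ draw_line ov c (Right_to_Left # es) =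
        comb n (\<not> ov) (Suc c) @ [(Suc c, \<not> ov), (Suc c, \<not> \<not> ov)] @ draw_line ov (Suc c) es"
    using \<open>c < n\<close> by (simp add: comb_less[of c n])
  also have "\<dots> \<approx>\<^bsub>Suc n\<^esub> comb n (\<not> ov) (Suc c) @ [] @ draw_line ov (Suc c) es"
    using \<open>c < n\<close> by (intro isotopic_context cancel_letters) auto
  also have "\<dots> \<approx>\<^bsub>Suc n\<^esub> forget_line es @ comb n (\<not> ov) (line_position (Suc c) es)"
    using 4 by simp
  finally show ?case by simp
qed

lemma draw_line_isotopic:
  assumes "valid_events n c es"
  shows "draw_line ov c es \<approx>\<^bsub>Suc n\<^esub>
    inverse_word (comb n (\<not> ov) c) @ forget_line es @ comb n (\<not> ov) (line_position c es)"
proof -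
  have "draw_line ov c es \<approx>\<^bsub>Suc n\<^esub>
        inverse_word (comb n (\<not> ov) c) @ comb n (\<not> ov) c @ draw_line ov c es"
    using cancel_left[of "comb n (\<not> ov) c" "Suc n" "[]"] by (simp add: equivclp_sym)
  also have "\<dots> \<approx>\<^bsub>Suc n\<^esub>
    inverse_word (comb n (\<not> ov) c) @ forget_line es @ comb n (\<not> ov) (line_position c es)"
    by (intro isotopic_prepend comb_draw_line assms)
  finally show ?thesis .
qed

section \<open>An algebraic description of L-moves\<close>

lemma line_position_append: "line_position c (es @ fs) = line_position (line_position c es) fs"
  by (induction c es rule: line_position.induct) auto

lemma forget_line_append: "forget_line (es @ fs) = forget_line es @ forget_line fs"
  by (induction es rule: forget_line.induct) auto

lemma line_moves_freely:
  assumes "c \<le> n" "d \<le> n"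
  shows "\<exists>es. forget_line es = [] \<and> valid_events n c es \<and> line_position c es = d"
proof (cases "c \<le> d")
  case True
  then show ?thesis
  proof (induction c rule: inc_induct)
    case base
    show ?case using assms by (intro exI[of _ "[]"]) simp
  next
    case (step c)
    then obtain es where
      "forget_line es = []" "valid_events n (Suc c) es" "line_position (Suc c) es = d" by blast
    with step assms show ?case by (intro exI[of _ "Right_to_Left # es"]) simp
  qed
next
  case False
  then have "d \<le> c" by simp
  from this assms(1) show ?thesis
  proof (induction c rule: dec_induct)
    case base
    show ?case using assms by (intro exI[of _ "[]"]) simp
  next
    case (step c)
    then obtain es where
      "forget_line es = []" "valid_events n c es" "line_position c es = d" by force
    with step show ?case by (intro exI[of _ "Left_to_Right # es"]) simp
  qed
qed

text \<open>The line avoids every crossing by moving to the far left before it.\<close>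

lemma line_steering:
  assumes "w \<in> braid_diagrams n" "c \<le> n" "d \<le> n"
  shows "\<exists>es. forget_line es = w \<and> valid_events n c es \<and> line_position c es = d"
  using assms
proof (induction w arbitrary: c)
  case Nil
  then show ?case using line_moves_freely by blast
next
  case (Cons x w)
  obtain i s where x: "x = (i, s)" by force
  obtain es where es: "forget_line es = []" "valid_events n c es" "line_position c es = 0"
    using line_moves_freely[of c n 0] Cons.prems by blast
  obtain fs where fs: "forget_line fs = w" "valid_events n 0 fs" "line_position 0 fs = d"
    using Cons.IH[of 0] Cons.prems by (auto simp: x)
  show ?case
    using es fs Cons.prems
    by (intro exI[of _ "es @ Crossing i s # fs"])
      (simp add: x forget_line_append valid_events_append line_position_append)
qed

text \<open>The normal form of an L-move on \<open>a @ b\<close> at a point between \<open>a\<close> and \<open>b\<close>: the vertical line has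
  \<open>c\<close> strands to its left at the top and at the bottom, \<open>p\<close> just above the point and \<open>q\<close> just
  below it.\<close>

definition L_word :: "nat \<Rightarrow> bool \<Rightarrow> nat \<Rightarrow> braid_diagram \<Rightarrow> nat \<Rightarrow> nat \<Rightarrow> braid_diagram \<Rightarrow> braid_diagram"
  where "L_word n e c a p q b =
    inverse_word (comb n e c) @ a @ comb n e p @ inverse_word (comb n e q) @ b @ comb n e c"

lemma L_drawing_isotopic:
  assumes "diagram_with_line n c (us @ x # vs)"
    and "p = line_position c us" "q = line_position c (us @ [x])"
  shows "draw_line ov c us @ draw_line ov q vs \<approx>\<^bsub>Suc n\<^esub>
    L_word n (\<not> ov) c (forget_line us) p q (forget_line vs)"
proof -
  have valid: "valid_events n c us" "valid_events n q vs"
    using assms(1) valid_events_append[of n c "us @ [x]" vs] assms(3)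
    by (auto simp: diagram_with_line_def valid_events_append)
  have "line_position q vs = c"
    using assms(1) line_position_append[of c "us @ [x]" vs] assms(3)
    by (simp add: diagram_with_line_def)
  then show ?thesis
    using isotopic_append[OF draw_line_isotopic[OF valid(1), of ov] draw_line_isotopic[OF valid(2), of ov]]
    by (simp add: L_word_def assms(2))
qed

lemma L_move_cases:
  assumes "L_move x y"
  obtains n a b c p q e where
    "x = (n, braid_of n (a @ b))" "y = (Suc n, braid_of (Suc n) (L_word n e c a p q b))"
    "a \<in> braid_diagrams n" "b \<in> braid_diagrams n"
    "p \<le> n" "q \<le> n" "p = Suc q \<or> q = Suc p"
  using assms
proof cases
  case (1 n c us x vs ov)
  define p where "p = line_position c us"
  define q where "q = line_position c (us @ [x])"
  have valid: "valid_events n c us" "valid_events n p [x]" "valid_events n q vs"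
    using 1(3) valid_events_append[of n c "us @ [x]" vs]
    by (auto simp: diagram_with_line_def valid_events_append p_def q_def)
  have q: "q = line_position p [x]"
    by (simp add: p_def q_def line_position_append)
  have "forget_line [x] = []" using 1(4) by auto
  then have forget: "forget_line (us @ x # vs) = forget_line us @ forget_line vs"
    using forget_line_append[of us "[x] @ vs"] forget_line_append[of "[x]" vs] by simp
  have pq: "p = Suc q \<or> q = Suc p" "p \<le> n" "q \<le> n"
    using valid 1(4) q by auto
  have "draw_line ov c us @ draw_line ov q vs \<approx>\<^bsub>Suc n\<^esub>
      L_word n (\<not> ov) c (forget_line us) p q (forget_line vs)"
    using L_drawing_isotopic[OF 1(3) p_def q_def] .
  from braid_of_eqI[OF this] show ?thesis
    using 1(1,2) pq valid forget by (intro that) (auto simp: q_def forget_line_in_braid_diagrams)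
qed

lemma L_move_wordI:
  assumes "a \<in> braid_diagrams n" "b \<in> braid_diagrams n"
    and "c \<le> n" "p \<le> n" "q \<le> n" "p = Suc q \<or> q = Suc p"
  shows "L_move (n, braid_of n (a @ b)) (Suc n, braid_of (Suc n) (L_word n e c a p q b))"
proof -
  obtain us where us: "forget_line us = a" "valid_events n c us" "line_position c us = p"
    using line_steering assms by blast
  obtain vs where vs: "forget_line vs = b" "valid_events n q vs" "line_position q vs = c"
    using line_steering assms by blast
  obtain x where x: "x \<in> {Left_to_Right, Right_to_Left}" "valid_events n p [x]"
    "line_position p [x] = q" "forget_line [x] = []"
    using assms that[of Left_to_Right] that[of Right_to_Left] by auto
  have dia: "diagram_with_line n c (us @ x # vs)"
    using us vs x valid_events_append[of n c us "[x] @ vs"] valid_events_append[of n p "[x]" vs]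
      line_position_append[of c us "[x] @ vs"] line_position_append[of p "[x]" vs]
    by (simp add: diagram_with_line_def)
  have q: "line_position c (us @ [x]) = q"
    using us x by (simp add: line_position_append)
  have forget: "forget_line (us @ x # vs) = a @ b"
    using us vs x forget_line_append[of us "[x] @ vs"] forget_line_append[of "[x]" vs] by simp
  have "braid_of (Suc n) (draw_line (\<not> e) c us @ draw_line (\<not> e) q vs) =
        braid_of (Suc n) (L_word n e c a p q b)"
    using L_drawing_isotopic[OF dia us(3)[symmetric] q[symmetric], of "\<not> e"] us vs
    by (intro braid_of_eqI) simp
  with L_move.intros[OF dia x(1), of "\<not> e"] show ?thesis
    by (simp only: forget q)
qed

section \<open>Markov equivalence on words\<close>

lemma inv_braid_of:
  assumes "w \<in> braid_diagrams n"
  shows "inv\<^bsub>braid_group n\<^esub> braid_of n w = braid_of n (inverse_word w)"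
proof (rule group.inv_equality[OF group_braid_group])
  show "braid_of n (inverse_word w) \<otimes>\<^bsub>braid_group n\<^esub> braid_of n w = \<one>\<^bsub>braid_group n\<^esub>"
    using assms braid_of_eqI[OF inverse_word_left[OF assms]]
    by (simp add: mult_braid_of one_braid_group)
qed (use assms in \<open>auto simp: carrier_braid_group\<close>)

lemma add_strand_braid_of:
  assumes "w \<in> braid_diagrams n"
  shows "add_strand n (braid_of n w) = braid_of (Suc n) w"
proof -
  have "braid_of (Suc n) v = braid_of (Suc n) w" if "v \<in> braid_of n w" for v
    using that isotopic_mono[of n w v "Suc n"]
    by (intro braid_of_eqI) (auto simp: braid_of_def isotopy_def intro: equivclp_sym)
  moreover have "w \<in> braid_of n w"
    using assms by (simp add: braid_of_def isotopy_def)
  ultimately show ?thesis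
    unfolding add_strand_def by blast
qed

lemma markov_conjugate:
  assumes "1 \<le> n" "a \<in> braid_diagrams n" "w \<in> braid_diagrams n"
  shows "markov_move (n, braid_of n a) (n, braid_of n (inverse_word w @ a @ w))"
  using markov_move.conjugation[of n "braid_of n a" "braid_of n w"] assms
  by (simp add: carrier_braid_group mult_braid_of inv_braid_of)

lemma markov_rotate:
  assumes "1 \<le> n" "a \<in> braid_diagrams n" "b \<in> braid_diagrams n"
  shows "markov_equivalent (n, braid_of n (a @ b)) (n, braid_of n (b @ a))"
proof -
  have "braid_of n (inverse_word a @ (a @ b) @ a) = braid_of n (b @ a)"
    using cancel_left[OF assms(2), of "[]" "b @ a"] by (intro braid_of_eqI) simp
  with markov_conjugate[of n "a @ b" a] assms show ?thesis
    by (auto simp: markov_equivalent_def)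
qed

lemma markov_stabilise:
  assumes "1 \<le> n" "a \<in> braid_diagrams n"
  shows "markov_move (n, braid_of n a) (Suc n, braid_of (Suc n) (a @ [(n, t)]))"
proof -
  have a: "a \<in> braid_diagrams (Suc n)" "braid_of n a \<in> carrier (braid_group n)"
    using assms by (auto intro: braid_diagrams_Suc simp: carrier_braid_group)
  show ?thesis
  proof (cases t)
    case True
    then show ?thesis
      using markov_move.stabilisation_pos[OF assms(1) a(2)] a assms
      by (simp add: add_strand_braid_of sigma_def mult_braid_of)
  next
    case False
    then show ?thesis
      using markov_move.stabilisation_neg[OF assms(1) a(2)] a assms
      by (simp add: add_strand_braid_of sigma_def mult_braid_of inv_braid_of)
  qed
qed

section \<open>L-moves are Markov equivalences\<close>

text \<open>By induction on the number of strands to the right of position \<open>q\<close>: the relation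
  \<open>\<sigma>\<^sub>q\<^sub>+\<^sub>1\<^sup>e \<sigma>\<^sub>q\<^sup>t \<sigma>\<^sub>q\<^sub>+\<^sub>1\<^sup>-\<^sup>e = \<sigma>\<^sub>q\<^sup>-\<^sup>e \<sigma>\<^sub>q\<^sub>+\<^sub>1\<^sup>t \<sigma>\<^sub>q\<^sup>e\<close> moves the inner crossing one step to the right, and \<open>\<sigma>\<^sub>q\<close> commutes
  with the comb that remains, so it joins the conjugating braid.\<close>

lemma comb_conjugate:
  assumes "1 \<le> q" "q \<le> n"
  shows "\<exists>g \<in> braid_diagrams n.
    comb n e q @ [(q, t)] @ inverse_word (comb n e q) \<approx>\<^bsub>Suc n\<^esub> g @ [(n, t)] @ inverse_word g"
  using assms(2,1)
proof (induction rule: inc_induct)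
  case base
  show ?case by (intro bexI[of _ "[]"]) simp_all
next
  case (step q)
  let ?C = "comb n e (Suc q)"
  have far: "?C @ [(q, s)] \<approx>\<^bsub>Suc n\<^esub> [(q, s)] @ ?C" for s
    using step by (intro comb_commute) auto
  obtain g where g: "g \<in> braid_diagrams n"
    "?C @ [(Suc q, t)] @ inverse_word ?C \<approx>\<^bsub>Suc n\<^esub> g @ [(n, t)] @ inverse_word g"
    using step by auto
  let ?h = "(q, \<not> e) # g"
  have braid: "[(Suc q, e), (q, t), (Suc q, \<not> e)] \<approx>\<^bsub>Suc n\<^esub> [(q, \<not> e), (Suc q, t), (q, e)]"
  proof -
    have "[(Suc q, e), (q, t), (Suc q, \<not> e)] \<approx>\<^bsub>Suc n\<^esub>
          [(q, \<not> e), (q, \<not> \<not> e)] @ [(Suc q, e), (q, t), (Suc q, \<not> e)]"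
      using isotopic_context[OF cancel_letters[of q "Suc n" "\<not> e"], of "[]"] step
      by (simp add: equivclp_sym)
    also have "\<dots> = [(q, \<not> e)] @ [(q, e), (Suc q, e), (q, t)] @ [(Suc q, \<not> e)]"
      by simp
    also have "\<dots> \<approx>\<^bsub>Suc n\<^esub> [(q, \<not> e)] @ [(Suc q, t), (q, e), (Suc q, e)] @ [(Suc q, \<not> e)]"
      using step by (intro isotopic_context braid_relation_mirror) auto
    also have "\<dots> = [(q, \<not> e), (Suc q, t), (q, e)] @ [(Suc q, e), (Suc q, \<not> e)] @ []"
      by simp
    also have "\<dots> \<approx>\<^bsub>Suc n\<^esub> [(q, \<not> e), (Suc q, t), (q, e)] @ [] @ []"
      using step by (intro isotopic_context cancel_letters) auto
    finally show ?thesis by simp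
  qed
  have "comb n e q @ [(q, t)] @ inverse_word (comb n e q) =
        ?C @ [(Suc q, e), (q, t), (Suc q, \<not> e)] @ inverse_word ?C"
    using step by (simp add: comb_less[of q n])
  also have "\<dots> \<approx>\<^bsub>Suc n\<^esub> ?C @ [(q, \<not> e), (Suc q, t), (q, e)] @ inverse_word ?C"
    by (intro isotopic_context braid)
  also have "\<dots> = (?C @ [(q, \<not> e)]) @ [(Suc q, t)] @ inverse_word (?C @ [(q, \<not> e)])"
    by simp
  also have "\<dots> \<approx>\<^bsub>Suc n\<^esub>
      ([(q, \<not> e)] @ ?C) @ [(Suc q, t)] @ inverse_word ([(q, \<not> e)] @ ?C)"
    using step by (intro isotopic_append isotopic_inverse_word far equivclp_refl) auto
  also have "\<dots> = [(q, \<not> e)] @ (?C @ [(Suc q, t)] @ inverse_word ?C) @ [(q, e)]"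
    by simp
  also have "\<dots> \<approx>\<^bsub>Suc n\<^esub> [(q, \<not> e)] @ (g @ [(n, t)] @ inverse_word g) @ [(q, e)]"
    by (intro isotopic_context g)
  also have "\<dots> = ?h @ [(n, t)] @ inverse_word ?h"
    by simp
  finally show ?case
    using g step by (intro bexI[of _ ?h]) auto
qed

lemma L_move_imp_markov:
  assumes "L_move x y"
  shows "markov_equivalent x y"
  using assms
proof (cases rule: L_move_cases)
  case (1 n a b c p q e)
  have trans: "markov_equivalent u w" if "markov_equivalent u v" "markov_equivalent v w" for u v w
    using that unfolding markov_equivalent_def by (rule equivclp_trans)
  have sym: "markov_equivalent v u" if "markov_equivalent u v" for u v
    using that unfolding markov_equivalent_def by (rule equivclp_sym)
  have n: "1 \<le> n" using 1 by auto
  have Suc: "w \<in> braid_diagrams (Suc n)" if "w \<in> braid_diagrams n" for w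
    using that by (rule braid_diagrams_Suc)
  let ?D = "comb n e"
  obtain r t where r: "1 \<le> r" "r \<le> n"
    "?D p @ inverse_word (?D q) = ?D r @ [(r, t)] @ inverse_word (?D r)"
  proof (cases "p = Suc q")
    case True
    with 1 that[of p "\<not> e"] show ?thesis by (simp add: comb_less[of q n])
  next
    case False
    with 1 that[of q e] show ?thesis by (simp add: comb_less[of p n])
  qed
  then obtain g where g: "g \<in> braid_diagrams n"
    "?D p @ inverse_word (?D q) \<approx>\<^bsub>Suc n\<^esub> g @ [(n, t)] @ inverse_word g"
    using comb_conjugate[of r n e t] by auto
  have "L_word n e c a p q b =
      inverse_word (?D c) @ (a @ (?D p @ inverse_word (?D q)) @ b) @ ?D c"
    by (simp add: L_word_def)
  also have "\<dots> \<approx>\<^bsub>Suc n\<^esub>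
      inverse_word (?D c) @ (a @ (g @ [(n, t)] @ inverse_word g) @ b) @ ?D c"
    by (intro isotopic_context g)
  finally have L: "braid_of (Suc n) (L_word n e c a p q b) =
      braid_of (Suc n) (inverse_word (?D c) @ (a @ (g @ [(n, t)] @ inverse_word g) @ b) @ ?D c)"
    by (rule braid_of_eqI)
  have "markov_equivalent (n, braid_of n (a @ b)) (n, braid_of n (b @ a))"
    using 1 n by (intro markov_rotate)
  also have "markov_equivalent \<dots> (n, braid_of n (inverse_word g @ (b @ a) @ g))"
    unfolding markov_equivalent_def
    using 1 n g by (intro r_into_equivclp markov_conjugate) auto
  also (trans) have "markov_equivalent \<dots>
      (Suc n, braid_of (Suc n) ((inverse_word g @ (b @ a) @ g) @ [(n, t)]))"
    unfolding markov_equivalent_def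
    using 1 n g by (intro r_into_equivclp markov_stabilise) auto
  also (trans) have "(inverse_word g @ (b @ a) @ g) @ [(n, t)] =
      (inverse_word g @ b) @ (a @ g @ [(n, t)])"
    by simp
  also have "markov_equivalent (Suc n, braid_of (Suc n) \<dots>)
      (Suc n, braid_of (Suc n) ((a @ g @ [(n, t)]) @ (inverse_word g @ b)))"
    using 1 n g by (intro markov_rotate) (auto intro: Suc)
  also (trans) have "markov_equivalent \<dots> (Suc n, braid_of (Suc n)
      (inverse_word (?D c) @ ((a @ g @ [(n, t)]) @ (inverse_word g @ b)) @ ?D c))"
    unfolding markov_equivalent_def
    using 1 n g by (intro r_into_equivclp markov_conjugate) (auto intro: Suc)
  finally (trans) show ?thesis
    using 1 L by simp
qed

section \<open>Markov moves are L-equivalences\<close>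

lemma L_trans [trans]: "L_equivalent x y \<Longrightarrow> L_equivalent y z \<Longrightarrow> L_equivalent x z"
  unfolding L_equivalent_def by (rule equivclp_trans)

lemma L_stabilise:
  assumes "1 \<le> n" "a \<in> braid_diagrams n"
  shows "L_move (n, braid_of n a) (Suc n, braid_of (Suc n) (a @ [(n, t)]))"
proof -
  have "L_word n (\<not> t) n a n (n - 1) [] = a @ [(n, t)]"
    using assms comb_less[of "n - 1" n "\<not> t"] by (simp add: L_word_def)
  with L_move_wordI[of a n "[]" n n "n - 1" "\<not> t"] assms show ?thesis by simp
qed

text \<open>The strand to cut is the one that goes from position \<open>i + 1\<close> to position \<open>i\<close> in the crossing, and
  the new arcs run over or under everything according to what this strand does in the crossing.  In
  \<open>a \<sigma>\<^sub>i\<^sup>e\<close> it is cut just above the crossing, in \<open>\<sigma>\<^sub>i\<^sup>e a\<close> just below it.  The piece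
  of the cut strand that contains the crossing is then, together with the new arc attached to it,
  on one level throughout, and can be straightened so that the crossing disappears.  The choices \<open>c = i + 1\<close> and \<open>c = i - 1\<close> of the line put the end-points of the two results
  at the same places.\<close>

lemma L_rotate_letter:
  assumes "a \<in> braid_diagrams n" "1 \<le> i" "i < n"
  shows "L_equivalent (n, braid_of n (a @ [(i, e)])) (n, braid_of n ([(i, e)] @ a))"
proof -
  let ?D = "comb n e"
  let ?X = "inverse_word (?D (i + 1)) @ a @ ?D (i - 1)"
  have Di: "?D i = ?D (i + 1) @ [(i + 1, e)]" "?D (i - 1) = ?D i @ [(i, e)]"
    using assms comb_less[of i n e] comb_less[of "i - 1" n e] by auto
  have "L_word n e (i + 1) a i (i + 1) [(i, e)] =
      (inverse_word (?D (i + 1)) @ a @ ?D i @ inverse_word (?D (i + 1))) @ ([(i, e)] @ ?D (i + 1))"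
    by (simp add: L_word_def)
  also have "\<dots> \<approx>\<^bsub>Suc n\<^esub>
      (inverse_word (?D (i + 1)) @ a @ ?D i @ inverse_word (?D (i + 1))) @ (?D (i + 1) @ [(i, e)])"
    using assms by (intro isotopic_prepend equivclp_sym[OF comb_commute]) auto
  also have "\<dots> = (inverse_word (?D (i + 1)) @ a @ ?D i) @ inverse_word (?D (i + 1)) @ ?D (i + 1) @ [(i, e)]"
    by simp
  also have "\<dots> \<approx>\<^bsub>Suc n\<^esub> (inverse_word (?D (i + 1)) @ a @ ?D i) @ [(i, e)]"
    by (rule cancel_left) simp
  also have "\<dots> = ?X"
    unfolding Di(2) by simp
  finally have right: "braid_of (Suc n) (L_word n e (i + 1) a i (i + 1) [(i, e)]) = braid_of (Suc n) ?X"
    by (rule braid_of_eqI)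
  have "L_word n e (i - 1) [(i, e)] (i - 1) i a =
      inverse_word (?D (i - 1)) @ ([(i, e)] @ ?D (i - 1)) @ inverse_word (?D i) @ a @ ?D (i - 1)"
    by (simp add: L_word_def)
  also have "\<dots> \<approx>\<^bsub>Suc n\<^esub>
      inverse_word (?D (i - 1)) @ (?D (i - 1) @ [(Suc i, e)]) @ inverse_word (?D i) @ a @ ?D (i - 1)"
    using assms by (intro isotopic_context equivclp_sym[OF comb_shift]) auto
  also have "\<dots> \<approx>\<^bsub>Suc n\<^esub> [(Suc i, e)] @ inverse_word (?D i) @ a @ ?D (i - 1)"
    using cancel_left[of "?D (i - 1)" "Suc n" "[]"] by simp
  also have "\<dots> = [] @ [(i + 1, e), (i + 1, \<not> e)] @ ?X"
    by (simp add: Di(1))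
  also have "\<dots> \<approx>\<^bsub>Suc n\<^esub> [] @ [] @ ?X"
    using assms by (intro isotopic_context cancel_letters) auto
  finally have left: "braid_of (Suc n) (L_word n e (i - 1) [(i, e)] (i - 1) i a) = braid_of (Suc n) ?X"
    by (simp add: braid_of_eqI)
  have "L_move (n, braid_of n (a @ [(i, e)])) (Suc n, braid_of (Suc n) ?X)"
    using L_move_wordI[of a n "[(i, e)]" "i + 1" i "i + 1" e] assms right by simp
  moreover have "L_move (n, braid_of n ([(i, e)] @ a)) (Suc n, braid_of (Suc n) ?X)"
    using L_move_wordI[of "[(i, e)]" n a "i - 1" "i - 1" i e] assms left by simp
  ultimately show ?thesis
    unfolding L_equivalent_def by (meson equivclp_sym equivclp_trans r_into_equivclp)
qed

lemma L_rotate: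
  assumes "b \<in> braid_diagrams n" "a \<in> braid_diagrams n"
  shows "L_equivalent (n, braid_of n (a @ b)) (n, braid_of n (b @ a))"
  using assms
proof (induction b arbitrary: a)
  case Nil
  show ?case by (simp add: L_equivalent_def)
next
  case (Cons x b)
  obtain i s where x: "x = (i, s)" by force
  have "L_equivalent (n, braid_of n ((a @ [x]) @ b)) (n, braid_of n ((b @ a) @ [x]))"
    using Cons.IH[of "a @ [x]"] Cons.prems by (simp add: x)
  also have "L_equivalent \<dots> (n, braid_of n ([x] @ b @ a))"
    unfolding x using Cons.prems by (intro L_rotate_letter) (auto simp: x)
  finally show ?case by simp
qed

lemma markov_move_imp_L:
  assumes "markov_move x y"
  shows "L_equivalent x y"
  using assms
proof cases
  case (conjugation n \<alpha> \<beta>)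
  obtain a b where ab: "a \<in> braid_diagrams n" "b \<in> braid_diagrams n"
    "\<alpha> = braid_of n a" "\<beta> = braid_of n b"
    using conjugation by (auto simp: carrier_braid_group)
  have "braid_of n (b @ inverse_word b @ a) = braid_of n a"
    using cancel_right[OF ab(2), of "[]" a] by (intro braid_of_eqI) simp
  moreover have "L_equivalent (n, braid_of n (b @ inverse_word b @ a))
      (n, braid_of n ((inverse_word b @ a) @ b))"
    using ab by (intro L_rotate) auto
  ultimately show ?thesis
    using conjugation ab by (simp add: mult_braid_of inv_braid_of)
next
  case (stabilisation_pos n \<alpha>)
  then obtain a where a: "a \<in> braid_diagrams n" "\<alpha> = braid_of n a"
    by (auto simp: carrier_braid_group)
  then show ?thesis
    using stabilisation_pos L_stabilise[of n a True]
    by (simp add: add_strand_braid_of sigma_def mult_braid_of braid_diagrams_Suc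
        L_equivalent_def r_into_equivclp)
next
  case (stabilisation_neg n \<alpha>)
  then obtain a where a: "a \<in> braid_diagrams n" "\<alpha> = braid_of n a"
    by (auto simp: carrier_braid_group)
  then show ?thesis
    using stabilisation_neg L_stabilise[of n a False]
    by (simp add: add_strand_braid_of sigma_def mult_braid_of inv_braid_of braid_diagrams_Suc
        L_equivalent_def r_into_equivclp)
qed

lemma equivclp_le:
  assumes "equivclp r x y" "\<And>a b. r a b \<Longrightarrow> equivclp s a b"
  shows "equivclp s x y"
  using assms(1)
proof (induction rule: equivclp_induct)
  case base
  show ?case by simp
next
  case (step y z)
  then show ?case by (meson assms(2) equivclp_sym equivclp_trans)
qed

theorem mainTheorem5:
  fixes n m :: nat and \<alpha> \<beta> :: "braid_diagram set"
  assumes "n \<ge> 1" and "m \<ge> 1"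
    and "\<alpha> \<in> carrier (braid_group n)" and "\<beta> \<in> carrier (braid_group m)"
  shows "L_equivalent (n, \<alpha>) (m, \<beta>) \<longleftrightarrow> markov_equivalent (n, \<alpha>) (m, \<beta>)"
proof
  assume "L_equivalent (n, \<alpha>) (m, \<beta>)"
  then show "markov_equivalent (n, \<alpha>) (m, \<beta>)"
    using L_move_imp_markov unfolding L_equivalent_def markov_equivalent_def by (rule equivclp_le)
next
  assume "markov_equivalent (n, \<alpha>) (m, \<beta>)"
  then show "L_equivalent (n, \<alpha>) (m, \<beta>)"
    using markov_move_imp_L unfolding L_equivalent_def markov_equivalent_def by (rule equivclp_le)
qed

end
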